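(* Let $\mathcal{G}=(\mathbf{A},\mathbf{B},\mathbf{C},\mathbf{D})$ be a minimal, asymptotically stable linear system with $\mathbf{A}\in\mathbb{R}^{n\times n}$, $\mathbf{B}\in\mathbb{R}^{n\times m}$, $\mathbf{C}\in\mathbb{R}^{m\times n}$ and $\mathbf{D}\in\mathbb{R}^{m\times m}$ nonsingular, with transfer function $\mathbf{G}(s)=\mathbf{C}(s\mathbf{I}_n-\mathbf{A})^{-1}\mathbf{B}+\mathbf{D}$. Let $\mathbf{P}\in\mathbb{R}^{n\times n}$ be the reachability Gramian of $\mathcal G$, i.e. the unique solution of $$\mathbf{A}\mathbf{P}+\mathbf{P}\mathbf{A}^{\mathsf T}+\mathbf{B}\mathbf{B}^{\mathsf T}=\mathbf{0},$$ put $\mathbf{B}_{\mathcal W}:=\mathbf{P}\mathbf{C}^{\mathsf T}+\mathbf{B}\mathbf{D}^{\mathsf T}$, and let $\mathbf{Q}_{\mathcal W}^{-}\in\mathbb{R}^{n\times n}$ be the minimal (stabilizing) solution of the algebraic Riccati equation $$\mathbf{A}^{\mathsf T}\mathbf{Q}_{\mathcal W}+\mathbf{Q}_{\mathcal W}\mathbf{A}+\big(\mathbf{C}-\mathbf{B}_{\mathcal W}^{\mathsf T}\mathbf{Q}_{\mathcal W}\big)^{\mathsf T}(\mathbf{D}\mathbf{D}^{\mathsf T})^{-1}\big(\mathbf{C}-\mathbf{B}_{\mathcal W}^{\mathsf T}\mathbf{Q}_{\mathcal W}\big)=\mathbf{0}.$$ Set $$\mathbf{C}_{\mathcal W}:=(\mathbf{D}\mathbf{D}^{\mathsf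 T})^{-1/2}\big(\mathbf{C}-\mathbf{B}_{\mathcal W}^{\mathsf T}\mathbf{Q}_{\mathcal W}^{-}\big),\qquad \mathbf{W}(s):=\mathbf{C}_{\mathcal W}(s\mathbf{I}_n-\mathbf{A})^{-1}\mathbf{B}_{\mathcal W}+(\mathbf{D}\mathbf{D}^{\mathsf T})^{1/2}.$$ With the choices $\mathbf{B}_{\mathcal X}=\mathbf{B}$ and $\mathbf{C}_{\mathcal Y}=\mathbf{C}_{\mathcal W}$, define $$\mathbf{G}_{\sigma,\mathbf{A}}(s)=\mathbf{C}_{\mathcal Y}(s\mathbf{I}_n-\mathbf{A})^{-1}\mathbf{B}_{\mathcal X},\quad \mathbf{G}_{\mathbf{B}}(s)=\mathbf{C}_{\mathcal Y}(s\mathbf{I}_n-\mathbf{A})^{-1}\mathbf{B},\quad \mathbf{G}_{\mathbf{C}}(s)=\mathbf{C}(s\mathbf{I}_n-\mathbf{A})^{-1}\mathbf{B}_{\mathcal X}.$$ Then $$\mathbf{G}_{\mathbf{C}}(s)=\mathbf{G}_\infty(s)\qquad\text{and}\qquad \mathbf{G}_{\sigma,\mathbf{A}}(s)=\mathbf{G}_{\mathbf{B}}(s)=\Big[\big(\mathbf{W}(-s)^{\mathsf T}\big)^{-1}\mathbf{G}_\infty(s)\Big]_+ .$$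
   Context: A quadruple $(\mathbf{A},\mathbf{B},\mathbf{C},\mathbf{D})$ denotes the system $\dot{\mathbf x}=\mathbf{A}\mathbf{x}+\mathbf{B}\mathbf{u}$, $\mathbf{y}=\mathbf{C}\mathbf{x}+\mathbf{D}\mathbf{u}$; it is asymptotically stable if $\mathbf{A}$ is Hurwitz (all eigenvalues in the open left half-plane), and minimal if it is reachable and observable. For a proper rational matrix function $\mathbf{F}(s)$, $\mathbf{F}_\infty(s):=\mathbf{F}(s)-\lim_{z\to\infty}\mathbf{F}(z)$ is its strictly proper part; in particular $\mathbf{G}_\infty(s)=\mathbf{C}(s\mathbf{I}_n-\mathbf{A})^{-1}\mathbf{B}$. For a strictly proper rational matrix function $\mathbf{F}$, $[\mathbf{F}(s)]_+$ denotes its purely stable part: the strictly proper summand with all poles in the open left half-plane in the (unique) decomposition of $\mathbf{F}$ into such a summand plus a strictly proper summand with no poles in the open left half-plane. The minimal solution of the Riccati equation is the symmetric positive definite solution $\mathbf{Q}_{\mathcal W}^{-}$ with $\mathbf{0}\prec\mathbf{Q}_{\mathcal W}^{-}\preceq\mathbf{Q}_{\mathcal W}$ (Loewner order) for all symmetric solutions $\mathbf{Q}_{\mathcal W}$; it is the stabilizing solution, meaning that $\mathbf{A}-\mathbf{B}_{\mathcal W}(\mathbf{D}\mathbf{D}^{\mathsf T})^{-1}(\mathbf{C}-\mathbf{B}_{\mathcal W}^{\mathsf T}\mathbf{Q}_{\mathcal W}^{-})$ is Hurwitz. The powers $(\mathbf{D}\mathbf{D}^{\mathsf T})^{\pm1/2}$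 are the symmetric positive definite ones. $\mathbf{W}$ is a minimum phase right spectral factor: $\mathbf{G}(s)\mathbf{G}(-s)^{\mathsf T}=\mathbf{W}(-s)^{\mathsf T}\mathbf{W}(s)$. *)

theory Defs
  imports
    "HOL-Analysis.Analysis"
    "HOL-Computational_Algebra.Computational_Algebra"
    "HOL-Computational_Algebra.Field_as_Ring"
begin

section \<open>Real matrices\<close>

definition spd :: "real^'n^'n \<Rightarrow> bool" where
  "spd M \<longleftrightarrow> transpose M = M \<and> (\<forall>x. x \<noteq> 0 \<longrightarrow> x \<bullet> (M *v x) > 0)"

definition loewner_le :: "real^'n^'n \<Rightarrow> real^'n^'n \<Rightarrow> bool" (infix "\<preceq>" 50) where
  "M \<preceq> N \<longleftrightarrow> (\<forall>x. x \<bullet> (M *v x) \<le> x \<bullet> (N *v x))"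

definition is_spd_sqrt :: "real^'n^'n \<Rightarrow> real^'n^'n \<Rightarrow> bool" where
  "is_spd_sqrt S M \<longleftrightarrow> spd S \<and> S ** S = M"

text \<open>Eigenvalues of a real matrix are taken over the complex numbers.\<close>

definition hurwitz :: "real^'n^'n \<Rightarrow> bool" where
  "hurwitz A \<longleftrightarrow>
     (\<forall>z v. v \<noteq> 0 \<and> map_matrix complex_of_real A *v v = z *s v \<longrightarrow> Re z < 0)"


section \<open>Linear systems\<close>

definition state_trajectory ::
    "real^'n^'n \<Rightarrow> real^'m^'n \<Rightarrow> (real \<Rightarrow> real^'m) \<Rightarrow> real set \<Rightarrow> (real \<Rightarrow> real^'n) \<Rightarrow> bool" where
  "state_trajectory A B u T x \<longleftrightarrow>
     (\<forall>t\<in>T. (x has_vector_derivative (A *v x t + B *v u t)) (at t within T))"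

text \<open>
  Every state can be reached from the origin in finite time, with a continuous input. (For linear
  systems enlarging the class of inputs, e.g. to square-integrable ones, does not enlarge the set
  of reachable states.)
\<close>

definition reachable :: "real^'n^'n \<Rightarrow> real^'m^'n \<Rightarrow> bool" where
  "reachable A B \<longleftrightarrow>
     (\<forall>\<xi>. \<exists>\<tau>>0. \<exists>u x. continuous_on {0..\<tau>} u \<and> state_trajectory A B u {0..\<tau>} x \<and>
            x 0 = 0 \<and> x \<tau> = \<xi>)"

text \<open>The initial state is determined by the input and the output.\<close>

definition observable ::
    "real^'n^'n \<Rightarrow> real^'m^'n \<Rightarrow> real^'n^'p \<Rightarrow> real^'m^'p \<Rightarrow> bool" where
  "observable A B C D \<longleftrightarrow>
     (\<forall>u x x'. continuous_on {0..} u \<and>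
        state_trajectory A B u {0..} x \<and> state_trajectory A B u {0..} x' \<and>
        (\<forall>t\<ge>0. C *v x t + D *v u t = C *v x' t + D *v u t)
        \<longrightarrow> x 0 = x' 0)"

definition minimal_system ::
    "real^'n^'n \<Rightarrow> real^'m^'n \<Rightarrow> real^'n^'p \<Rightarrow> real^'m^'p \<Rightarrow> bool" where
  "minimal_system A B C D \<longleftrightarrow> reachable A B \<and> observable A B C D"


section \<open>Rational matrix functions\<close>

text \<open>
  A rational function is an element of the field of fractions of the polynomial ring over the
  complex numbers, so that equality is equality of rational functions, i.e. of their values at
  all points that are not poles.
\<close>

type_synonym ratfun = "complex poly fract"

definition rf_const :: "complex \<Rightarrow> ratfun" where
  "rf_const c = to_fract [:c:]"

definition rf_s :: ratfun where
  "rf_s = to_fract [:0, 1:]"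

text \<open>
  The function \<open>quot_of_fract\<close> returns numerator and denominator in lowest terms, so the poles are
  exactly the zeros of the denominator. At a pole the value \<open>rf_eval f z\<close> is the dummy value \<open>0\<close>.
\<close>

definition rf_eval :: "ratfun \<Rightarrow> complex \<Rightarrow> complex" where
  "rf_eval f z = poly (fst (quot_of_fract f)) z / poly (snd (quot_of_fract f)) z"

definition rf_poles :: "ratfun \<Rightarrow> complex set" where
  "rf_poles f = {z. poly (snd (quot_of_fract f)) z = 0}"

text \<open>The substitution of \<open>-s\<close> for \<open>s\<close>.\<close>

definition rf_reflect :: "ratfun \<Rightarrow> ratfun" where
  "rf_reflect f =
     to_fract (pcompose (fst (quot_of_fract f)) [:0, -1:]) /
     to_fract (pcompose (snd (quot_of_fract f)) [:0, -1:])"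

abbreviation const_matrix :: "real^'n^'m \<Rightarrow> ratfun^'n^'m" where
  "const_matrix M \<equiv> map_matrix (\<lambda>x. rf_const (complex_of_real x)) M"

abbreviation reflect_matrix :: "ratfun^'n^'m \<Rightarrow> ratfun^'n^'m" where
  "reflect_matrix F \<equiv> map_matrix rf_reflect F"

definition matrix_poles :: "ratfun^'n^'m \<Rightarrow> complex set" where
  "matrix_poles F = (\<Union>i j. rf_poles (F $ i $ j))"

definition strictly_proper :: "ratfun^'n^'m \<Rightarrow> bool" where
  "strictly_proper F \<longleftrightarrow> (\<forall>i j. (rf_eval (F $ i $ j) \<longlongrightarrow> 0) at_infinity)"

text \<open>Only meaningful for proper \<open>F\<close>, as otherwise the limit does not exist.\<close>

definition strictly_proper_part :: "ratfun^'n^'m \<Rightarrow> ratfun^'n^'m" where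
  "strictly_proper_part F = F - map_matrix (\<lambda>f. rf_const (Lim at_infinity (rf_eval f))) F"

text \<open>
  The summand \<open>H\<close> is unique: the difference of two candidates has no poles at all, hence is a
  polynomial, and it vanishes at infinity.
\<close>

definition stable_part :: "ratfun^'n^'m \<Rightarrow> ratfun^'n^'m" where
  "stable_part F =
     (THE H. strictly_proper H \<and> (\<forall>z\<in>matrix_poles H. Re z < 0) \<and>
        (\<exists>K. F = H + K \<and> strictly_proper K \<and> (\<forall>z\<in>matrix_poles K. \<not> Re z < 0)))"

definition state_tf ::
    "real^'n^'n \<Rightarrow> real^'m^'n \<Rightarrow> real^'n^'p \<Rightarrow> ratfun^'m^'p" where
  "state_tf A B C =
     const_matrix C ** matrix_inv (mat rf_s - const_matrix A) ** const_matrix B"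

definition transfer_function ::
    "real^'n^'n \<Rightarrow> real^'m^'n \<Rightarrow> real^'n^'p \<Rightarrow> real^'m^'p \<Rightarrow> ratfun^'m^'p" where
  "transfer_function A B C D = state_tf A B C + const_matrix D"


section \<open>The algebraic Riccati equation\<close>

definition riccati_solution ::
    "real^'n^'n \<Rightarrow> real^'m^'n \<Rightarrow> real^'n^'m \<Rightarrow> real^'m^'m \<Rightarrow> real^'n^'n \<Rightarrow> bool" where
  "riccati_solution A B\<^sub>W C D Q \<longleftrightarrow>
     transpose A ** Q + Q ** A +
     transpose (C - transpose B\<^sub>W ** Q) ** matrix_inv (D ** transpose D) **
       (C - transpose B\<^sub>W ** Q) = 0"

text \<open>
  The minimal solution is also required to be stabilizing: for systems with zeros on the
  imaginary axis the first three conditions do not imply the last one.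
\<close>

definition minimal_riccati_solution ::
    "real^'n^'n \<Rightarrow> real^'m^'n \<Rightarrow> real^'n^'m \<Rightarrow> real^'m^'m \<Rightarrow> real^'n^'n \<Rightarrow> bool" where
  "minimal_riccati_solution A B\<^sub>W C D Q \<longleftrightarrow>
     riccati_solution A B\<^sub>W C D Q \<and> spd Q \<and>
     (\<forall>Q'. transpose Q' = Q' \<and> riccati_solution A B\<^sub>W C D Q' \<longrightarrow> Q \<preceq> Q') \<and>
     hurwitz (A - B\<^sub>W ** matrix_inv (D ** transpose D) ** (C - transpose B\<^sub>W ** Q))"

end

theory Submission
  imports Defs
begin

text \<open>
  The theorem rests on an explicit decomposition of \<open>(W(-s)\<^sup>T)\<inverse> G\<^sub>\<infinity>(s)\<close>. Let
  \<open>A\<^sub>c = A - B\<^sub>W R\<inverse> C\<^sub>W\<close> be the closed-loop matrix of the Riccati equation. Since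
  \<open>W(-s)\<^sup>T = R - B\<^sub>W\<^sup>T (sI + A\<^sup>T)\<inverse> C\<^sub>W\<^sup>T\<close>, one finds
  \<open>(W(-s)\<^sup>T)\<inverse> C (sI - A)\<inverse> B = C\<^sub>W (sI - A)\<inverse> B + R\<inverse> B\<^sub>W\<^sup>T (sI + A\<^sub>c\<^sup>T)\<inverse> Q B\<close>.
  Multiplied by \<open>W(-s)\<^sup>T\<close>, this is an identity between products of constant matrices and
  resolvents, in which everything cancels by the Riccati equation in the form
  \<open>C\<^sub>W\<^sup>T C\<^sub>W = Q (sI - A) - (sI + A\<^sup>T) Q\<close>, by \<open>C\<^sub>W\<^sup>T R\<inverse> B\<^sub>W\<^sup>T = (sI + A\<^sup>T) - (sI + A\<^sub>c\<^sup>T)\<close> and by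
  \<open>C = R C\<^sub>W + B\<^sub>W\<^sup>T Q\<close>; see \<open>spectral_factor_identity\<close>.

  The first summand is strictly proper with poles among the eigenvalues of the Hurwitz matrix
  \<open>A\<close>. The second is strictly proper with poles among the eigenvalues of \<open>- A\<^sub>c\<^sup>T\<close>, which lie in
  the open right half-plane because \<open>Q\<close> is stabilizing. By uniqueness of such a decomposition
  (\<open>stable_part_eqI\<close>) the first summand is the stable part.

  That \<open>G\<^sub>C = G\<^sub>\<infinity>\<close> only says that \<open>C (sI - A)\<inverse> B\<close> vanishes at infinity, so that the limit of \<open>G\<close>
  there is \<open>D\<close>.

  Pole locations and behaviour at infinity are both read off from limits: the entries of a
  resolvent are, by Cramer's rule, quotients of determinants, so they converge wherever the
  determinant in the denominator has a nonzero limit.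
\<close>

section \<open>Evaluating rational functions\<close>

lemma rf_quot: "f * to_fract (snd (quot_of_fract f)) = to_fract (fst (quot_of_fract f))"
proof -
  have "to_fract (fst (quot_of_fract f)) / to_fract (snd (quot_of_fract f)) = f"
    by (metis Fract_conv_to_fract Fract_quot_of_fract)
  thus ?thesis
    by (simp add: field_simps)
qed

lemma rf_quot_cross:
  assumes "f * to_fract q = to_fract p"
  shows "fst (quot_of_fract f) * q = p * snd (quot_of_fract f)"
proof -
  let ?n = "fst (quot_of_fract f)" and ?d = "snd (quot_of_fract f)"
  have "to_fract ?n * to_fract q = f * to_fract ?d * to_fract q"
    by (simp only: rf_quot)
  also have "\<dots> = f * to_fract q * to_fract ?d"
    by (simp only: mult_ac)
  finally have "to_fract (?n * q) = to_fract (p * ?d)"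
    by (simp only: assms to_fract_mult)
  thus ?thesis
    by (simp only: to_fract_eq_iff)
qed

lemma rf_quot_add:
  "(f + g) * to_fract (snd (quot_of_fract f) * snd (quot_of_fract g)) =
     to_fract (fst (quot_of_fract f) * snd (quot_of_fract g) +
       fst (quot_of_fract g) * snd (quot_of_fract f))"
proof -
  let ?a = "fst (quot_of_fract f)" and ?b = "snd (quot_of_fract f)"
  let ?c = "fst (quot_of_fract g)" and ?d = "snd (quot_of_fract g)"
  have "(f + g) * to_fract (?b * ?d) =
      (f * to_fract ?b) * to_fract ?d + (g * to_fract ?d) * to_fract ?b"
    by (simp add: algebra_simps)
  thus ?thesis
    by (simp add: rf_quot)
qed

lemma rf_quot_mult:
  "(f * g) * to_fract (snd (quot_of_fract f) * snd (quot_of_fract g)) =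
     to_fract (fst (quot_of_fract f) * fst (quot_of_fract g))"
proof -
  let ?a = "fst (quot_of_fract f)" and ?b = "snd (quot_of_fract f)"
  let ?c = "fst (quot_of_fract g)" and ?d = "snd (quot_of_fract g)"
  have "(f * g) * to_fract (?b * ?d) = (f * to_fract ?b) * (g * to_fract ?d)"
    by (simp add: algebra_simps)
  thus ?thesis
    by (simp add: rf_quot)
qed

text \<open>
  Values and poles can be read off from any representation as a quotient, as long as its
  denominator does not vanish at the point: the reduced denominator divides every other one.
\<close>

lemma rf_eval_eqI:
  assumes pq: "f * to_fract q = to_fract p" and qz: "poly q z \<noteq> 0"
  shows "rf_eval f z = poly p z / poly q z" "z \<notin> rf_poles f"
proof -
  let ?n = "fst (quot_of_fract f)" and ?d = "snd (quot_of_fract f)"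
  note eq = rf_quot_cross[OF pq]
  have "?d dvd ?n * q"
    by (simp add: eq)
  hence "?d dvd q"
    using coprime_quot_of_fract[of f]
    by (simp add: coprime_dvd_mult_right_iff coprime_commute)
  hence dz: "poly ?d z \<noteq> 0"
    using qz by (auto elim!: dvdE)
  show "z \<notin> rf_poles f"
    using dz by (simp add: rf_poles_def)
  have "poly ?n z * poly q z = poly p z * poly ?d z"
    by (simp only: eq flip: poly_mult)
  thus "rf_eval f z = poly p z / poly q z"
    using dz qz by (simp add: rf_eval_def field_simps)
qed

lemma rf_eval_const: "rf_eval (rf_const c) z = c"
  by (simp add: rf_eval_def rf_const_def)

lemma rf_const_0 [simp]: "rf_const 0 = 0"
  by (simp add: rf_const_def)

lemma rf_const_1 [simp]: "rf_const 1 = 1"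
  by (simp add: rf_const_def flip: one_pCons)

lemma rf_const_add: "rf_const (a + b) = rf_const a + rf_const b"
  by (simp add: rf_const_def flip: to_fract_add)

lemma rf_const_mult: "rf_const (a * b) = rf_const a * rf_const b"
  by (simp add: rf_const_def flip: to_fract_mult)

lemma rf_const_minus: "rf_const (- a) = - rf_const a"
  by (simp add: rf_const_def flip: to_fract_uminus)

lemma rf_const_diff: "rf_const (a - b) = rf_const a - rf_const b"
  using rf_const_add[of a "- b"] by (simp add: rf_const_minus)

lemma rf_eval_s: "rf_eval rf_s z = z"
  by (simp add: rf_eval_def rf_s_def)

lemma rf_eval_add:
  assumes "z \<notin> rf_poles f" "z \<notin> rf_poles g"
  shows "rf_eval (f + g) z = rf_eval f z + rf_eval g z"
  using rf_eval_eqI(1)[OF rf_quot_add[of f g], of z] assms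
  by (simp add: rf_poles_def rf_eval_def add_frac_eq)

lemma rf_eval_mult:
  assumes "z \<notin> rf_poles f" "z \<notin> rf_poles g"
  shows "rf_eval (f * g) z = rf_eval f z * rf_eval g z"
  using rf_eval_eqI(1)[OF rf_quot_mult[of f g], of z] assms
  by (simp add: rf_poles_def rf_eval_def)

lemma finite_rf_poles: "finite (rf_poles f)"
  unfolding rf_poles_def by (rule poly_roots_finite) simp

section \<open>Limits of rational functions\<close>

text \<open>
  Limits are taken along filters \<open>F \<le> cofinite\<close>. A rational function has finitely many poles, so
  along such a filter evaluation is eventually a ring homomorphism, and one set of limit rules
  serves both points of the plane, where convergence means absence of a pole, and infinity, where
  convergence to \<open>0\<close> means strict properness.
\<close>

lemma at_le_cofinite: "at (z::complex) \<le> cofinite"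
  unfolding le_filter_def eventually_cofinite
proof safe
  fix P :: "complex \<Rightarrow> bool"
  assume "finite {x. \<not> P x}"
  hence "open (- ({x. \<not> P x} - {z}))"
    by (intro open_Compl finite_imp_closed) simp
  thus "eventually P (at z)"
    unfolding eventually_at_topological
    by (intro exI[of _ "- ({x. \<not> P x} - {z})"]) auto
qed

lemma at_infinity_le_cofinite: "(at_infinity :: complex filter) \<le> cofinite"
  unfolding le_filter_def eventually_cofinite
proof safe
  fix P :: "complex \<Rightarrow> bool"
  assume "finite {x. \<not> P x}"
  hence "bounded {x. \<not> P x}"
    by (rule finite_imp_bounded)
  then obtain b where b: "\<And>x. \<not> P x \<Longrightarrow> norm x \<le> b"
    by (auto simp: bounded_iff)
  show "eventually P at_infinity"
    unfolding eventually_at_infinity by (rule exI[of _ "b + 1"]) (use b in force)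
qed

lemma eventually_not_rf_pole:
  assumes "F \<le> cofinite"
  shows "eventually (\<lambda>z. z \<notin> rf_poles f) F"
proof -
  have "eventually (\<lambda>z. z \<notin> rf_poles f) cofinite"
    by (simp add: eventually_cofinite finite_rf_poles)
  thus ?thesis
    using assms filter_leD by blast
qed

context
  fixes F :: "complex filter"
  assumes F: "F \<le> cofinite"
begin

lemma rf_tendsto_const: "(rf_eval (rf_const c) \<longlongrightarrow> c) F"
  by (simp add: rf_eval_const[abs_def])

lemma rf_tendsto_add:
  assumes "(rf_eval f \<longlongrightarrow> a) F" "(rf_eval g \<longlongrightarrow> b) F"
  shows "(rf_eval (f + g) \<longlongrightarrow> a + b) F"
proof (rule Lim_transform_eventually[OF tendsto_add[OF assms]])
  show "eventually (\<lambda>z. rf_eval f z + rf_eval g z = rf_eval (f + g) z) F"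
    using eventually_not_rf_pole[OF F, of f] eventually_not_rf_pole[OF F, of g]
    by eventually_elim (simp add: rf_eval_add)
qed

lemma rf_tendsto_mult:
  assumes "(rf_eval f \<longlongrightarrow> a) F" "(rf_eval g \<longlongrightarrow> b) F"
  shows "(rf_eval (f * g) \<longlongrightarrow> a * b) F"
proof (rule Lim_transform_eventually[OF tendsto_mult[OF assms]])
  show "eventually (\<lambda>z. rf_eval f z * rf_eval g z = rf_eval (f * g) z) F"
    using eventually_not_rf_pole[OF F, of f] eventually_not_rf_pole[OF F, of g]
    by eventually_elim (simp add: rf_eval_mult)
qed

lemma rf_tendsto_minus:
  assumes "(rf_eval f \<longlongrightarrow> a) F"
  shows "(rf_eval (- f) \<longlongrightarrow> - a) F"
proof -
  have "rf_const (-1) * f = - f"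
    by (simp add: rf_const_minus)
  thus ?thesis
    using rf_tendsto_mult[OF rf_tendsto_const[of "-1"] assms] by simp
qed

lemma rf_tendsto_diff:
  assumes "(rf_eval f \<longlongrightarrow> a) F" "(rf_eval g \<longlongrightarrow> b) F"
  shows "(rf_eval (f - g) \<longlongrightarrow> a - b) F"
  using rf_tendsto_add[OF assms(1) rf_tendsto_minus[OF assms(2)]] by simp

lemma rf_tendsto_divide:
  assumes "(rf_eval f \<longlongrightarrow> a) F" "(rf_eval g \<longlongrightarrow> b) F" "b \<noteq> 0"
  shows "(rf_eval (f / g) \<longlongrightarrow> a / b) F"
proof (cases "F = bot")
  case False
  have "g \<noteq> 0"
  proof
    assume "g = 0"
    hence "rf_eval g = (\<lambda>z. 0)"
      by (auto simp: rf_eval_def)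
    thus False
      using assms(2,3) False tendsto_unique[of F "\<lambda>z. 0" b 0] by auto
  qed
  show ?thesis
  proof (rule Lim_transform_eventually[OF tendsto_divide[OF assms]])
    show "eventually (\<lambda>z. rf_eval f z / rf_eval g z = rf_eval (f / g) z) F"
      using eventually_not_rf_pole[OF F, of "f / g"] eventually_not_rf_pole[OF F, of g]
        tendsto_imp_eventually_ne[OF assms(2,3)]
    proof eventually_elim
      case (elim z)
      have "rf_eval (f / g * g) z = rf_eval (f / g) z * rf_eval g z"
        using elim by (intro rf_eval_mult)
      thus ?case
        using elim \<open>g \<noteq> 0\<close> by (simp add: field_simps)
    qed
  qed
qed simp

lemma rf_tendsto_sum:
  assumes "\<And>i. i \<in> I \<Longrightarrow> (rf_eval (f i) \<longlongrightarrow> a i) F"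
  shows "(rf_eval (sum f I) \<longlongrightarrow> sum a I) F"
  using assms
proof (induction I rule: infinite_finite_induct)
  case (insert x I)
  thus ?case
    using rf_tendsto_add by simp
qed (use rf_tendsto_const[of 0] in \<open>simp_all\<close>)

lemma rf_tendsto_prod:
  assumes "\<And>i. i \<in> I \<Longrightarrow> (rf_eval (f i) \<longlongrightarrow> a i) F"
  shows "(rf_eval (prod f I) \<longlongrightarrow> prod a I) F"
  using assms
proof (induction I rule: infinite_finite_induct)
  case (insert x I)
  thus ?case
    using rf_tendsto_mult by simp
qed (use rf_tendsto_const[of 1] in \<open>simp_all\<close>)

lemma rf_tendsto_det:
  fixes M :: "ratfun^'n^'n"
  assumes "\<And>i j. (rf_eval (M $ i $ j) \<longlongrightarrow> L $ i $ j) F"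
  shows "(rf_eval (det M) \<longlongrightarrow> det L) F"
  unfolding det_def
proof (intro rf_tendsto_sum rf_tendsto_mult rf_tendsto_prod assms)
  fix p :: "'n \<Rightarrow> 'n"
  show "(rf_eval (of_int (sign p)) \<longlongrightarrow> of_int (sign p)) F"
    using rf_tendsto_const[of 1] rf_tendsto_const[of "-1"]
    by (cases p rule: sign_cases) (simp_all add: rf_const_minus)
qed

lemma rf_det_nonzero:
  fixes M :: "ratfun^'n^'n"
  assumes "\<And>i j. (rf_eval (M $ i $ j) \<longlongrightarrow> L $ i $ j) F" "det L \<noteq> 0" "F \<noteq> bot"
  shows "det M \<noteq> 0"
proof
  assume "det M = 0"
  hence "rf_eval (det M) = (\<lambda>z. 0)"
    by (auto simp: rf_eval_def)
  thus False
    using rf_tendsto_det[OF assms(1)] assms(2,3) tendsto_unique[of F "\<lambda>z. 0" "det L" 0]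
    by auto
qed

text \<open>
  Cramer's rule writes each entry of the inverse as a quotient of two determinants of matrices
  with convergent entries, and the limit of the denominator is nonzero.
\<close>

lemma rf_convergent_inverse:
  fixes M X :: "ratfun^'n^'n"
  assumes M: "\<And>i j. (rf_eval (M $ i $ j) \<longlongrightarrow> L $ i $ j) F"
    and L: "det L \<noteq> 0" and "F \<noteq> bot" and MX: "M ** X = mat 1"
  shows "\<exists>l. (rf_eval (X $ k $ j) \<longlongrightarrow> l) F"
proof -
  have "M *v column j X = axis j 1"
    using MX by (simp add: vec_eq_iff matrix_matrix_mult_def matrix_vector_mult_def
        column_def mat_def axis_def)
  hence "column j X =
      (\<chi> k. det (\<chi> i l. if l = k then axis j 1 $ i else M $ i $ l) / det M)"
    using cramer[OF rf_det_nonzero[OF M L \<open>F \<noteq> bot\<close>]] by blast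
  hence X: "X $ k $ j = det (\<chi> i l. if l = k then axis j 1 $ i else M $ i $ l) / det M"
    by (simp add: column_def vec_eq_iff)
  have "(rf_eval (det (\<chi> i l. if l = k then axis j 1 $ i else M $ i $ l)) \<longlongrightarrow>
      det (\<chi> i l. if l = k then axis j 1 $ i else L $ i $ l)) F"
    using M rf_tendsto_const[of 0] rf_tendsto_const[of 1]
    by (intro rf_tendsto_det) (auto simp: axis_def)
  from rf_tendsto_divide[OF this rf_tendsto_det[OF M] L] X show ?thesis
    by auto
qed

end

text \<open>
  At a pole the denominator vanishes; if the function converged there, the numerator would have to
  vanish as well, contradicting coprimality.
\<close>

lemma tendsto_imp_not_rf_pole:
  assumes "(rf_eval f \<longlongrightarrow> l) (at z)"
  shows "z \<notin> rf_poles f"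
proof
  let ?n = "poly (fst (quot_of_fract f))" and ?d = "poly (snd (quot_of_fract f))"
  assume "z \<in> rf_poles f"
  hence dz: "?d z = 0"
    by (simp add: rf_poles_def)
  have "((\<lambda>w. rf_eval f w * ?d w) \<longlongrightarrow> l * ?d z) (at z)"
    by (intro tendsto_mult assms tendsto_poly tendsto_ident_at)
  moreover have "eventually (\<lambda>w. rf_eval f w * ?d w = ?n w) (at z)"
    using eventually_not_rf_pole[OF at_le_cofinite, of f]
    by eventually_elim (simp add: rf_eval_def rf_poles_def)
  ultimately have "(?n \<longlongrightarrow> 0) (at z)"
    using dz by (auto intro: Lim_transform_eventually)
  moreover have "(?n \<longlongrightarrow> ?n z) (at z)"
    by (intro tendsto_poly tendsto_ident_at)
  ultimately have "?n z = 0"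
    using tendsto_unique[OF at_neq_bot] by metis
  thus False
    using dz coprime_quot_of_fract[of f] coprime_poly_0 by blast
qed

lemma not_rf_pole_imp_tendsto:
  assumes "z \<notin> rf_poles f"
  shows "(rf_eval f \<longlongrightarrow> rf_eval f z) (at z)"
  using assms unfolding rf_eval_def[abs_def] rf_poles_def
  by (auto intro!: tendsto_intros)

text \<open>
  Without poles the denominator is constant by the fundamental theorem of algebra, and a
  polynomial that tends to \<open>0\<close> at infinity is \<open>0\<close>.
\<close>

lemma rf_eq_0_if_pole_free:
  assumes no_pole: "\<And>z. z \<notin> rf_poles f" and lim: "(rf_eval f \<longlongrightarrow> 0) at_infinity"
  shows "f = 0"
proof -
  let ?n = "fst (quot_of_fract f)" and ?d = "snd (quot_of_fract f)"
  have "\<not> (\<exists>z. poly ?d z = 0)"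
    using no_pole by (simp add: rf_poles_def)
  then obtain c where d: "?d = [:c:]" "c \<noteq> 0"
    using fundamental_theorem_of_algebra_alt[of ?d] by (metis pCons_0_0 snd_quot_of_fract_nonzero)
  have "((\<lambda>z. rf_eval f z * c) \<longlongrightarrow> 0 * c) at_infinity"
    by (intro tendsto_intros lim)
  hence n: "(poly ?n \<longlongrightarrow> 0) at_infinity"
    using d by (simp add: rf_eval_def)
  have "degree ?n = 0"
  proof (rule ccontr)
    assume "degree ?n \<noteq> 0"
    hence "filterlim (poly ?n) at_infinity at_infinity"
      by (intro filterlim_poly_at_infinity) simp
    thus False
      using n not_tendsto_and_filterlim_at_infinity trivial_limit_at_infinity by blast
  qed
  then obtain e where e: "?n = [:e:]"
    by (rule degree_eq_zeroE)
  have "poly ?n = (\<lambda>_. e)"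
    using e by auto
  hence "e = 0"
    using n tendsto_unique[OF trivial_limit_at_infinity, of "\<lambda>_. e" 0 e] by auto
  thus "f = 0"
    using e by (metis fst_quot_of_fract_eq_0_iff pCons_0_0)
qed

section \<open>Reflection\<close>

text \<open>
  Reflection, too, can be computed from any representation as a quotient; hence it is a
  ring homomorphism.
\<close>

lemma rf_reflect_eqI:
  assumes pq: "f * to_fract q = to_fract p" and q: "q \<noteq> 0"
  shows "rf_reflect f = to_fract (pcompose p [:0, -1:]) / to_fract (pcompose q [:0, -1:])"
proof -
  let ?n = "fst (quot_of_fract f)" and ?d = "snd (quot_of_fract f)"
  have "pcompose ?n [:0, -1:] * pcompose q [:0, -1:] =
      pcompose p [:0, -1:] * pcompose ?d [:0, -1:]"
    by (simp only: rf_quot_cross[OF pq] flip: pcompose_mult)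
  hence "to_fract (pcompose ?n [:0, -1:]) * to_fract (pcompose q [:0, -1:]) =
      to_fract (pcompose p [:0, -1:]) * to_fract (pcompose ?d [:0, -1:])"
    by (simp only: flip: to_fract_mult)
  moreover have "pcompose q [:0, -1:] \<noteq> 0" "pcompose ?d [:0, -1:] \<noteq> 0"
    using q by (simp_all add: pcompose_eq_0_iff)
  ultimately show ?thesis
    by (simp add: rf_reflect_def frac_eq_eq)
qed

lemma rf_reflect_add: "rf_reflect (f + g) = rf_reflect f + rf_reflect g"
  using rf_reflect_eqI[OF rf_quot_add[of f g]]
  by (simp add: rf_reflect_def pcompose_add pcompose_mult add_frac_eq pcompose_eq_0_iff)

lemma rf_reflect_mult: "rf_reflect (f * g) = rf_reflect f * rf_reflect g"
  using rf_reflect_eqI[OF rf_quot_mult[of f g]]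
  by (simp add: rf_reflect_def pcompose_mult)

lemma rf_reflect_const [simp]: "rf_reflect (rf_const c) = rf_const c"
  by (simp add: rf_reflect_def rf_const_def pcompose_1)

lemma rf_reflect_s: "rf_reflect rf_s = - rf_s"
  by (simp add: rf_reflect_def rf_s_def pcompose_pCons pcompose_1 flip: to_fract_uminus)

lemma rf_reflect_minus: "rf_reflect (- f) = - rf_reflect f"
  using rf_reflect_mult[of "rf_const (-1)" f]
  by (simp add: rf_const_minus del: rf_reflect_const)
    (metis mult_minus_left mult_1 rf_const_1 rf_const_minus rf_reflect_const)

lemma rf_reflect_diff: "rf_reflect (f - g) = rf_reflect f - rf_reflect g"
  using rf_reflect_add[of f "- g"] by (simp add: rf_reflect_minus)

lemma rf_reflect_0 [simp]: "rf_reflect 0 = 0"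
  using rf_reflect_const[of 0] by (simp del: rf_reflect_const)

lemma rf_reflect_1 [simp]: "rf_reflect 1 = 1"
  using rf_reflect_const[of 1] by (simp del: rf_reflect_const)

section \<open>Matrix algebra\<close>

lemma matrix_add_rdistrib: "(A + B) ** C = A ** C + B ** (C :: 'a::semiring_1^'p^'n)"
  by (simp add: vec_eq_iff matrix_matrix_mult_def sum.distrib distrib_right)

lemma matrix_mult_minus_left: "(- A) ** B = - (A ** (B :: 'a::ring_1^'p^'n))"
  by (simp add: vec_eq_iff matrix_matrix_mult_def sum_negf)

lemma matrix_mult_minus_right: "A ** (- B) = - (A ** (B :: 'a::ring_1^'p^'n))"
  by (simp add: vec_eq_iff matrix_matrix_mult_def sum_negf)

lemma matrix_diff_ldistrib: "A ** (B - C) = A ** B - A ** (C :: 'a::ring_1^'p^'n)"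
  using matrix_add_ldistrib[of A B "- C"] by (simp add: matrix_mult_minus_right)

lemma matrix_diff_rdistrib: "(A - B) ** C = A ** C - B ** (C :: 'a::ring_1^'p^'n)"
  using matrix_add_rdistrib[of A "- B" C] by (simp add: matrix_mult_minus_left)

lemmas matrix_ring_simps =
  matrix_add_ldistrib matrix_add_rdistrib matrix_diff_ldistrib matrix_diff_rdistrib
  matrix_mult_minus_left matrix_mult_minus_right

lemma transpose_add: "transpose (A + B) = transpose A + transpose B"
  by (simp add: vec_eq_iff transpose_def)

lemma transpose_minus: "transpose (- A) = - transpose A"
  by (simp add: vec_eq_iff transpose_def)

lemma transpose_diff: "transpose (A - B) = transpose A - transpose B"
  by (simp add: vec_eq_iff transpose_def)

lemma transpose_map_matrix: "transpose (map_matrix h A) = map_matrix h (transpose A)"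
  by (simp add: vec_eq_iff transpose_def)

lemma mat_mult_nth: "(mat c ** X) $ i $ j = c * (X $ i $ j :: 'a::semiring_1)"
  by (simp add: matrix_matrix_mult_def mat_def if_distrib[of "\<lambda>x. x * _"] cong: if_cong)

lemma mult_mat_nth: "(X ** mat c) $ i $ j = (X $ i $ j :: 'a::semiring_1) * c"
  by (simp add: matrix_matrix_mult_def mat_def if_distrib[of "\<lambda>x. _ * x"] cong: if_cong)

lemma mat_commute: "mat c ** X = X ** mat (c :: 'a::comm_semiring_1)"
  by (simp add: vec_eq_iff mat_mult_nth mult_mat_nth mult.commute)

lemma map_matrix_mult:
  fixes h :: "'a::semiring_1 \<Rightarrow> 'b::semiring_1" and A :: "'a^'k^'m"
  assumes "h 0 = 0" "\<And>x y. h (x + y) = h x + h y" "\<And>x y. h (x * y) = h x * h y"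
  shows "map_matrix h (A ** B) = map_matrix h A ** map_matrix h B"
proof -
  have "h (sum f I) = (\<Sum>i\<in>I. h (f i))" for f and I :: "'k set"
    by (induction I rule: infinite_finite_induct) (simp_all add: assms)
  thus ?thesis
    by (simp add: vec_eq_iff matrix_matrix_mult_def assms)
qed

lemma matrix_inv_eqI:
  fixes A :: "'a::field^'n^'n"
  assumes "A ** B = mat 1"
  shows "matrix_inv A = B"
  unfolding matrix_inv_def
proof (rule some_equality)
  show "A ** B = mat 1 \<and> B ** A = mat 1"
    using assms matrix_left_right_inverse by blast
  fix X assume "A ** X = mat 1 \<and> X ** A = mat 1"
  thus "X = B"
    using assms by (metis matrix_mul_assoc matrix_mul_lid matrix_mul_rid)
qed

lemma det_nonzero_matrix_inv:
  fixes A :: "'a::field^'n^'n"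
  assumes "det A \<noteq> 0"
  shows "A ** matrix_inv A = mat 1" "matrix_inv A ** A = mat 1"
proof -
  obtain B where "A ** B = mat 1"
    using assms invertible_det_nz[of A] by (auto simp: invertible_def)
  thus "A ** matrix_inv A = mat 1" "matrix_inv A ** A = mat 1"
    using matrix_inv_eqI matrix_left_right_inverse by blast+
qed

abbreviation cmatrix :: "real^'n^'m \<Rightarrow> complex^'n^'m" where
  "cmatrix M \<equiv> map_matrix complex_of_real M"

lemma cmatrix_mult: "cmatrix (A ** B) = cmatrix A ** cmatrix B"
  by (rule map_matrix_mult) simp_all

lemma cmatrix_mat_1: "cmatrix (mat 1) = mat 1"
  by (simp add: vec_eq_iff mat_def)

lemma const_matrix_mult: "const_matrix (A ** B) = const_matrix A ** const_matrix B"
  by (rule map_matrix_mult) (simp_all add: rf_const_add rf_const_mult)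

lemma const_matrix_add: "const_matrix (A + B) = const_matrix A + const_matrix B"
  by (simp add: vec_eq_iff rf_const_add)

lemma const_matrix_minus: "const_matrix (- A) = - const_matrix A"
  by (simp add: vec_eq_iff rf_const_minus)

lemma const_matrix_mat_1: "const_matrix (mat 1) = mat 1"
  by (simp add: vec_eq_iff mat_def)

lemma const_matrix_diff: "const_matrix (A - B) = const_matrix A - const_matrix B"
  by (simp add: vec_eq_iff rf_const_diff)

lemma reflect_matrix_mult: "reflect_matrix (A ** B) = reflect_matrix A ** reflect_matrix B"
  by (rule map_matrix_mult) (simp_all add: rf_reflect_add rf_reflect_mult)

lemma reflect_matrix_add: "reflect_matrix (A + B) = reflect_matrix A + reflect_matrix B"
  by (simp add: vec_eq_iff rf_reflect_add)

lemma reflect_const_matrix: "reflect_matrix (const_matrix A) = const_matrix A"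
  by (simp add: vec_eq_iff)

section \<open>Limits of rational matrix functions\<close>

definition mat_tendsto :: "ratfun^'n^'m \<Rightarrow> complex^'n^'m \<Rightarrow> complex filter \<Rightarrow> bool" where
  "mat_tendsto M L F \<longleftrightarrow> (\<forall>i j. (rf_eval (M $ i $ j) \<longlongrightarrow> L $ i $ j) F)"

lemma mat_tendsto_const: "mat_tendsto (const_matrix A) (cmatrix A) F"
  by (simp add: mat_tendsto_def rf_eval_const[abs_def])

lemma mat_tendsto_add:
  assumes "F \<le> cofinite" "mat_tendsto M L F" "mat_tendsto N K F"
  shows "mat_tendsto (M + N) (L + K) F"
  using assms by (simp add: mat_tendsto_def rf_tendsto_add)

lemma mat_tendsto_diff:
  assumes "F \<le> cofinite" "mat_tendsto M L F" "mat_tendsto N K F"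
  shows "mat_tendsto (M - N) (L - K) F"
  using assms by (simp add: mat_tendsto_def rf_tendsto_diff)

lemma mat_tendsto_mult:
  assumes "F \<le> cofinite" "mat_tendsto M L F" "mat_tendsto N K F"
  shows "mat_tendsto (M ** N) (L ** K) F"
  using assms
  by (auto simp: mat_tendsto_def matrix_matrix_mult_def intro!: rf_tendsto_sum rf_tendsto_mult)

lemma mat_tendsto_inverse:
  fixes M X :: "ratfun^'n^'n"
  assumes F: "F \<le> cofinite" "F \<noteq> bot"
    and "mat_tendsto M L F" "det L \<noteq> 0" "M ** X = mat 1"
  shows "\<exists>K. mat_tendsto X K F"
proof -
  have "\<forall>i j. \<exists>l. (rf_eval (X $ i $ j) \<longlongrightarrow> l) F"
    using rf_convergent_inverse[OF F(1) _ assms(4) F(2) assms(5)] assms(3)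
    by (simp add: mat_tendsto_def)
  then obtain k where k: "\<And>i j. (rf_eval (X $ i $ j) \<longlongrightarrow> k i j) F"
    by metis
  have "mat_tendsto X (\<chi> i j. k i j) F"
    using k by (simp add: mat_tendsto_def)
  thus ?thesis
    by blast
qed

lemma strictly_proper_iff: "strictly_proper M \<longleftrightarrow> mat_tendsto M 0 at_infinity"
  by (simp add: strictly_proper_def mat_tendsto_def)

lemma not_matrix_pole_iff: "z \<notin> matrix_poles M \<longleftrightarrow> (\<exists>L. mat_tendsto M L (at z))"
proof
  assume "z \<notin> matrix_poles M"
  hence "mat_tendsto M (\<chi> i j. rf_eval (M $ i $ j) z) (at z)"
    by (simp add: mat_tendsto_def matrix_poles_def not_rf_pole_imp_tendsto)
  thus "\<exists>L. mat_tendsto M L (at z)"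
    by blast
next
  assume "\<exists>L. mat_tendsto M L (at z)"
  thus "z \<notin> matrix_poles M"
    unfolding mat_tendsto_def matrix_poles_def using tendsto_imp_not_rf_pole by blast
qed

text \<open>
  Uniqueness of the decomposition: if \<open>H + K = H' + K'\<close>, then \<open>H' - H = K - K'\<close> has no pole in
  the open left half-plane, seen from the right-hand side, and none outside it, seen from the
  left-hand side. Being strictly proper as well, it is \<open>0\<close>.
\<close>

lemma stable_part_eqI:
  assumes H: "strictly_proper H" "\<And>z. z \<in> matrix_poles H \<Longrightarrow> Re z < 0"
    and K: "strictly_proper K" "\<And>z. z \<in> matrix_poles K \<Longrightarrow> \<not> Re z < 0"
    and F: "F = H + K"
  shows "stable_part F = H"
  unfolding stable_part_def
proof (rule the_equality)
  show "strictly_proper H \<and> (\<forall>z\<in>matrix_poles H. Re z < 0) \<and>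
      (\<exists>K. F = H + K \<and> strictly_proper K \<and> (\<forall>z\<in>matrix_poles K. \<not> Re z < 0))"
    using assms by blast
next
  fix H'
  assume H': "strictly_proper H' \<and> (\<forall>z\<in>matrix_poles H'. Re z < 0) \<and>
      (\<exists>K'. F = H' + K' \<and> strictly_proper K' \<and> (\<forall>z\<in>matrix_poles K'. \<not> Re z < 0))"
  then obtain K' where "F = H' + K'" and K': "\<forall>z\<in>matrix_poles K'. \<not> Re z < 0"
    by blast
  hence sum: "H + K = H' + K'"
    by (simp only: F)
  have "H' = H + K - K'"
    unfolding sum by simp
  hence eq: "H' - H = K - K'"
    by simp
  have at_inf: "mat_tendsto (H' - H) 0 at_infinity"
    using mat_tendsto_diff[OF at_infinity_le_cofinite, of H' 0 H 0] H(1) H'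
    by (simp add: strictly_proper_iff)
  have no_pole: "z \<notin> matrix_poles (H' - H)" for z
  proof (cases "Re z < 0")
    case True
    hence "z \<notin> matrix_poles K" "z \<notin> matrix_poles K'"
      using K(2) K' by blast+
    thus ?thesis
      unfolding eq not_matrix_pole_iff using mat_tendsto_diff[OF at_le_cofinite] by blast
  next
    case False
    hence "z \<notin> matrix_poles H" "z \<notin> matrix_poles H'"
      using H(2) H' by blast+
    thus ?thesis
      unfolding not_matrix_pole_iff using mat_tendsto_diff[OF at_le_cofinite] by blast
  qed
  have "(H' - H) $ i $ j = 0" for i j
    using no_pole at_inf
    by (intro rf_eq_0_if_pole_free) (auto simp: matrix_poles_def mat_tendsto_def)
  thus "H' = H"
    by (simp add: vec_eq_iff)
qed

lemma strictly_proper_part_eqI: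
  assumes "strictly_proper H"
  shows "strictly_proper_part (H + const_matrix D) = H"
proof -
  have "mat_tendsto (H + const_matrix D) (0 + cmatrix D) at_infinity"
    using assms
    by (intro mat_tendsto_add mat_tendsto_const at_infinity_le_cofinite)
      (simp add: strictly_proper_iff)
  hence "Lim at_infinity (rf_eval ((H + const_matrix D) $ i $ j)) = complex_of_real (D $ i $ j)"
    for i j
    by (intro tendsto_Lim) (simp_all add: mat_tendsto_def trivial_limit_at_infinity)
  thus ?thesis
    by (simp add: strictly_proper_part_def vec_eq_iff)
qed

section \<open>The resolvent\<close>

abbreviation resolvent :: "real^'n^'n \<Rightarrow> ratfun^'n^'n" where
  "resolvent A \<equiv> matrix_inv (mat rf_s - const_matrix A)"

lemma rf_tendsto_inverse_s: "(rf_eval (inverse rf_s) \<longlongrightarrow> 0) at_infinity"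
proof (rule Lim_transform_eventually[OF tendsto_inverse_0])
  have "rf_eval (inverse rf_s) z = inverse z" if "z \<noteq> 0" for z
    using rf_eval_eqI(1)[of "inverse rf_s" "[:0, 1:]" 1 z] that
    by (simp add: rf_s_def inverse_eq_divide)
  moreover have "eventually (\<lambda>z::complex. z \<noteq> 0) at_infinity"
    by (rule eventually_not_equal_at_infinity)
  ultimately show "eventually (\<lambda>z. inverse z = rf_eval (inverse rf_s) z) at_infinity"
    by (auto elim: eventually_mono)
qed

text \<open>
  The diagonal entries of \<open>sI - A\<close> have no finite limit at infinity, but \<open>I - A / s\<close> tends to the
  identity, which is nonsingular. This gives both the invertibility of \<open>sI - A\<close> over the field of rational
  functions and, through Cramer's rule, the decay of the resolvent.
\<close>

lemma mat_tendsto_scaled_char_matrix: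
  "mat_tendsto (mat (inverse rf_s) ** (mat rf_s - const_matrix A)) (mat 1) at_infinity"
proof -
  have "rf_s \<noteq> 0"
    by (simp add: rf_s_def)
  hence "mat (inverse rf_s) ** (mat rf_s - const_matrix A) =
      const_matrix (mat 1) - mat (inverse rf_s) ** const_matrix A"
    by (simp add: vec_eq_iff mat_mult_nth) (simp add: mat_def algebra_simps)
  moreover have "mat_tendsto (mat (inverse rf_s)) (mat 0) at_infinity"
    using rf_tendsto_inverse_s rf_tendsto_const[of at_infinity 0]
    by (simp add: mat_tendsto_def mat_def at_infinity_le_cofinite)
  from mat_tendsto_diff[OF at_infinity_le_cofinite mat_tendsto_const[of "mat 1"]
      mat_tendsto_mult[OF at_infinity_le_cofinite this mat_tendsto_const[of A]]]
  have "mat_tendsto (const_matrix (mat 1) - mat (inverse rf_s) ** const_matrix A) (mat 1)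
      at_infinity"
    by (simp add: cmatrix_mat_1)
  ultimately show ?thesis
    by simp
qed

lemma
  shows resolvent_right: "(mat rf_s - const_matrix A) ** resolvent A = mat 1"
    and resolvent_left: "resolvent A ** (mat rf_s - const_matrix A) = mat 1"
proof -
  have "det (mat (inverse rf_s) ** (mat rf_s - const_matrix A)) \<noteq> 0"
    using mat_tendsto_scaled_char_matrix[of A]
    by (intro rf_det_nonzero[where F = at_infinity and L = "mat 1"])
      (simp_all add: mat_tendsto_def at_infinity_le_cofinite trivial_limit_at_infinity)
  hence "det (mat rf_s - const_matrix A) \<noteq> 0"
    by (simp add: det_mul)
  thus "(mat rf_s - const_matrix A) ** resolvent A = mat 1"
      "resolvent A ** (mat rf_s - const_matrix A) = mat 1"
    by (rule det_nonzero_matrix_inv)+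
qed

lemma resolvent_tendsto_0: "mat_tendsto (resolvent A) 0 at_infinity"
proof -
  let ?T = "mat (inverse rf_s) ** (mat rf_s - const_matrix A)"
  have s: "inverse rf_s * rf_s = 1"
    by (simp add: rf_s_def)
  have "?T ** (resolvent A ** mat rf_s) = mat (inverse rf_s) ** mat rf_s"
    by (metis matrix_mul_assoc matrix_mul_lid resolvent_right)
  also have "\<dots> = mat 1"
    by (simp add: vec_eq_iff mat_mult_nth) (simp add: mat_def s)
  finally obtain K where K: "mat_tendsto (resolvent A ** mat rf_s) K at_infinity"
    using mat_tendsto_inverse[OF at_infinity_le_cofinite trivial_limit_at_infinity
        mat_tendsto_scaled_char_matrix] by auto
  have "(rf_eval ((resolvent A ** mat rf_s) $ i $ j * inverse rf_s) \<longlongrightarrow> K $ i $ j * 0)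
      at_infinity" for i j
    using K by (intro rf_tendsto_mult at_infinity_le_cofinite rf_tendsto_inverse_s)
      (simp add: mat_tendsto_def)
  moreover have "(resolvent A ** mat rf_s) $ i $ j * inverse rf_s = resolvent A $ i $ j" for i j
    using s by (simp add: mult_mat_nth mult.assoc mult.commute)
  ultimately show ?thesis
    by (simp add: mat_tendsto_def)
qed

lemma resolvent_convergent:
  assumes "det (mat z - cmatrix A) \<noteq> 0"
  shows "\<exists>L. mat_tendsto (resolvent A) L (at z)"
proof (rule mat_tendsto_inverse[OF at_le_cofinite at_neq_bot _ assms resolvent_right])
  have "mat_tendsto (mat rf_s) (mat z) (at z)"
    using rf_tendsto_const[of "at z" 0]
    by (simp add: mat_tendsto_def mat_def at_le_cofinite rf_eval_s[abs_def])
  thus "mat_tendsto (mat rf_s - const_matrix A) (mat z - cmatrix A) (at z)"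
    by (intro mat_tendsto_diff at_le_cofinite mat_tendsto_const)
qed

lemma strictly_proper_state_tf: "strictly_proper (state_tf A B C)"
  using mat_tendsto_mult[OF at_infinity_le_cofinite
      mat_tendsto_mult[OF at_infinity_le_cofinite
        mat_tendsto_const[of C] resolvent_tendsto_0[of A]] mat_tendsto_const[of B]]
  by (simp add: strictly_proper_iff state_tf_def)

lemma det_eq_0_imp_eigenvector:
  fixes A :: "complex^'n^'n"
  assumes "det (mat z - A) = 0"
  shows "\<exists>v. v \<noteq> 0 \<and> A *v v = z *s v"
proof -
  have "\<not> (\<exists>B. B ** (mat z - A) = mat 1)"
    using assms invertible_det_nz[of "mat z - A"] invertible_left_inverse by blast
  then obtain v where "(mat z - A) *v v = 0" "v \<noteq> 0"
    unfolding matrix_left_invertible_ker by blast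
  moreover have "mat z *v v = z *s v"
    by (simp add: vec_eq_iff matrix_vector_mult_def mat_def if_distrib[of "\<lambda>x. x * _"]
        cong: if_cong)
  ultimately show ?thesis
    by (auto simp: matrix_vector_mult_diff_rdistrib)
qed

lemma pole_state_tf_imp_eigenvalue:
  assumes "z \<in> matrix_poles (state_tf A B C)"
  shows "det (mat z - cmatrix A) = 0"
proof (rule ccontr)
  assume "det (mat z - cmatrix A) \<noteq> 0"
  then obtain L where "mat_tendsto (resolvent A) L (at z)"
    using resolvent_convergent by blast
  hence "mat_tendsto (state_tf A B C) (cmatrix C ** L ** cmatrix B) (at z)"
    unfolding state_tf_def by (intro mat_tendsto_mult at_le_cofinite mat_tendsto_const)
  thus False
    using assms not_matrix_pole_iff by blast
qed

lemma hurwitz_state_tf_poles: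
  assumes "hurwitz A" "z \<in> matrix_poles (state_tf A B C)"
  shows "Re z < 0"
  using det_eq_0_imp_eigenvector[OF pole_state_tf_imp_eigenvalue[OF assms(2)]] assms(1)
  by (auto simp: hurwitz_def)

text \<open>
  The eigenvalues of \<open>- transpose A\<close> are those of \<open>A\<close> reflected in the origin, since transposition
  does not change the characteristic polynomial.
\<close>

lemma anti_hurwitz_state_tf_poles:
  assumes "hurwitz A" "z \<in> matrix_poles (state_tf (- transpose A) B C)"
  shows "Re z > 0"
proof -
  have "mat z - cmatrix (- transpose A) = transpose (mat z - cmatrix (- A))"
    by (simp add: transpose_diff transpose_map_matrix transpose_minus)
  hence "det (mat z - cmatrix (- A)) = 0"
    using pole_state_tf_imp_eigenvalue[OF assms(2)] by (simp add: det_transpose)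
  then obtain v where v: "v \<noteq> 0" "cmatrix (- A) *v v = z *s v"
    using det_eq_0_imp_eigenvector by blast
  have "cmatrix A *v v = - (cmatrix (- A) *v v)"
    by (simp add: vec_eq_iff matrix_vector_mult_def sum_negf)
  also have "\<dots> = (- z) *s v"
    by (simp add: v vec_eq_iff)
  finally have "Re (- z) < 0"
    using assms(1) v(1) unfolding hurwitz_def by blast
  thus ?thesis
    by simp
qed

text \<open>
  The para-Hermitian conjugate of \<open>(sI - A)\<inverse>\<close> is the transpose of \<open>(- sI - A)\<inverse>\<close>, that is
  \<open>- (sI + A\<^sup>T)\<inverse>\<close>: the adjoint system has state matrix \<open>- A\<^sup>T\<close>.
\<close>

lemma transpose_reflect_state_tf:
  fixes A :: "real^'n^'n"
  shows "transpose (reflect_matrix (state_tf A B C)) =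
     - state_tf (- transpose A) (transpose C) (transpose B)"
proof -
  let ?Y = "transpose (reflect_matrix (resolvent A))"
  have "reflect_matrix (mat rf_s - const_matrix A) = - (mat rf_s + const_matrix A)"
    by (simp add: vec_eq_iff mat_def rf_reflect_diff rf_reflect_s)
  moreover have "reflect_matrix (mat rf_s - const_matrix A) ** reflect_matrix (resolvent A) =
      reflect_matrix (mat 1)"
    by (simp only: resolvent_right flip: reflect_matrix_mult)
  moreover have "reflect_matrix (mat 1 :: ratfun^'n^'n) = mat 1"
    by (simp add: vec_eq_iff mat_def)
  ultimately have "transpose (- (mat rf_s + const_matrix A) ** reflect_matrix (resolvent A)) =
      mat 1"
    by simp
  hence "?Y ** (- (mat rf_s + const_matrix (transpose A))) = mat 1"
    by (simp add: matrix_transpose_mul transpose_diff transpose_minus transpose_map_matrix)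
  hence "- ?Y ** (mat rf_s - const_matrix (- transpose A)) = mat 1"
    by (simp add: matrix_ring_simps const_matrix_minus)
  hence "resolvent (- transpose A) = - ?Y"
    by (metis matrix_inv_eqI matrix_left_right_inverse)
  thus ?thesis
    by (simp add: state_tf_def reflect_matrix_mult reflect_const_matrix matrix_transpose_mul
        transpose_map_matrix matrix_mul_assoc matrix_mult_minus_left matrix_mult_minus_right)
qed

section \<open>The spectral factor\<close>

text \<open>
  The algebraic core, with the characteristic matrices abstracted to \<open>M\<^sub>1 = sI - A\<close>,
  \<open>M\<^sub>2 = sI + A\<^sup>T\<close> and \<open>M\<^sub>3 = sI + A\<^sub>c\<^sup>T\<close>, where \<open>A\<^sub>c\<close> is the closed-loop matrix. Then \<open>ric\<close> is the
  Riccati equation, the terms \<open>sQ\<close> cancelling in its right-hand side, and \<open>cl\<close> is the definition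
  of \<open>A\<^sub>c\<close>. Both express a product of constant matrices by characteristic matrices, which cancel
  against the resolvents \<open>X\<close>, \<open>N\<^sub>2\<close> and \<open>N\<close> next to them, so that the expanded product telescopes.
\<close>

lemma spectral_factor_identity:
  fixes X N\<^sub>2 N M\<^sub>1 M\<^sub>2 M\<^sub>3 Q :: "'a::field^'n^'n" and B' :: "'a^'n^'m"
    and C C\<^sub>W :: "'a^'n^'m" and C\<^sub>W' :: "'a^'m^'n" and R R' :: "'a^'m^'m"
  assumes X: "M\<^sub>1 ** X = mat 1" and N2: "N\<^sub>2 ** M\<^sub>2 = mat 1" and N: "M\<^sub>3 ** N = mat 1"
    and R: "R ** R' = mat 1"
    and C: "C = R ** C\<^sub>W + B' ** Q"
    and ric: "C\<^sub>W' ** C\<^sub>W = Q ** M\<^sub>1 - M\<^sub>2 ** Q"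
    and cl: "C\<^sub>W' ** R' ** B' = M\<^sub>2 - M\<^sub>3"
  shows "(R - B' ** N\<^sub>2 ** C\<^sub>W') ** (C\<^sub>W ** X + R' ** B' ** N ** Q) = C ** X"
proof -
  have "N\<^sub>2 ** (C\<^sub>W' ** C\<^sub>W) ** X = N\<^sub>2 ** Q ** (M\<^sub>1 ** X) - (N\<^sub>2 ** M\<^sub>2) ** Q ** X"
    unfolding ric by (simp only: matrix_ring_simps matrix_mul_assoc)
  hence 1: "N\<^sub>2 ** C\<^sub>W' ** C\<^sub>W ** X = N\<^sub>2 ** Q - Q ** X"
    by (simp add: X N2 matrix_mul_assoc)
  have "N\<^sub>2 ** (C\<^sub>W' ** R' ** B') ** N = (N\<^sub>2 ** M\<^sub>2) ** N - N\<^sub>2 ** (M\<^sub>3 ** N)"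
    unfolding cl by (simp only: matrix_ring_simps matrix_mul_assoc)
  hence 2: "N\<^sub>2 ** C\<^sub>W' ** R' ** B' ** N = N - N\<^sub>2"
    by (simp add: N N2 matrix_mul_assoc)
  have "(R - B' ** N\<^sub>2 ** C\<^sub>W') ** (C\<^sub>W ** X + R' ** B' ** N ** Q) =
      R ** C\<^sub>W ** X + (R ** R') ** B' ** N ** Q
      - B' ** (N\<^sub>2 ** C\<^sub>W' ** C\<^sub>W ** X) - B' ** (N\<^sub>2 ** C\<^sub>W' ** R' ** B' ** N) ** Q"
    by (simp only: matrix_ring_simps matrix_mul_assoc) (simp add: algebra_simps)
  also have "\<dots> = R ** C\<^sub>W ** X + B' ** Q ** X"
    unfolding 1 2 R by (simp add: matrix_ring_simps matrix_mul_assoc)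
  also have "\<dots> = C ** X"
    unfolding C by (simp add: matrix_ring_simps)
  finally show ?thesis .
qed

theorem theorem2:
  fixes A P Q :: "real^'n^'n"
    and B B\<^sub>W B\<^sub>X :: "real^'m^'n"
    and C C\<^sub>W C\<^sub>Y :: "real^'n^'m"
    and D R :: "real^'m^'m"
    and G W G\<^sub>\<sigma>\<^sub>A G\<^sub>B G\<^sub>C :: "ratfun^'m^'m"
  assumes "minimal_system A B C D"
    and "hurwitz A"
    and "invertible D"
    and "G = transfer_function A B C D"
    and "A ** P + P ** transpose A + B ** transpose B = 0"
    and "B\<^sub>W = P ** transpose C + B ** transpose D"
    and "minimal_riccati_solution A B\<^sub>W C D Q"
    and "is_spd_sqrt R (D ** transpose D)"
    and "C\<^sub>W = matrix_inv R ** (C - transpose B\<^sub>W ** Q)"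
    and "W = transfer_function A B\<^sub>W C\<^sub>W R"
    and "B\<^sub>X = B"
    and "C\<^sub>Y = C\<^sub>W"
    and "G\<^sub>\<sigma>\<^sub>A = state_tf A B\<^sub>X C\<^sub>Y"
    and "G\<^sub>B = state_tf A B C\<^sub>Y"
    and "G\<^sub>C = state_tf A B\<^sub>X C"
  shows "G\<^sub>C = strictly_proper_part G \<and>
         G\<^sub>\<sigma>\<^sub>A = G\<^sub>B \<and>
         G\<^sub>B = stable_part
           (matrix_inv (transpose (reflect_matrix W)) ** strictly_proper_part G)"
proof -
  let ?Ri = "matrix_inv R" and ?E = "C - transpose B\<^sub>W ** Q"
  have R_sym: "transpose R = R" and R_sq: "R ** R = D ** transpose D"
    using \<open>is_spd_sqrt R _\<close> by (auto simp: is_spd_sqrt_def spd_def)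
  have "det D \<noteq> 0"
    using \<open>invertible D\<close> by (simp add: invertible_det_nz)
  hence "det (R ** R) \<noteq> 0"
    by (simp add: R_sq det_mul det_transpose)
  hence "det R \<noteq> 0"
    by (simp add: det_mul)
  note Ri = det_nonzero_matrix_inv[OF this]
  \<comment> \<open>The transpose of the inverse is an inverse of \<open>R\<close> too, hence equal to it.\<close>
  have "transpose (?Ri ** R) = mat 1"
    by (simp add: Ri)
  hence Ri_sym: "transpose ?Ri = ?Ri"
    using matrix_inv_eqI[of R "transpose ?Ri"] by (simp add: matrix_transpose_mul R_sym)
  have "(R ** R) ** (?Ri ** ?Ri) = mat 1"
    by (metis Ri(1) matrix_mul_assoc matrix_mul_rid)
  hence inv_DD: "matrix_inv (D ** transpose D) = ?Ri ** ?Ri"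
    unfolding R_sq by (rule matrix_inv_eqI)
  have CWE: "C\<^sub>W = ?Ri ** ?E"
    by fact
  have "riccati_solution A B\<^sub>W C D Q" and
    hur: "hurwitz (A - B\<^sub>W ** matrix_inv (D ** transpose D) ** ?E)"
    using \<open>minimal_riccati_solution A B\<^sub>W C D Q\<close> by (auto simp: minimal_riccati_solution_def)
  hence "(transpose A ** Q + Q ** A) + transpose ?E ** (?Ri ** ?Ri) ** ?E = 0"
    by (simp add: riccati_solution_def inv_DD)
  moreover have "transpose C\<^sub>W ** C\<^sub>W = transpose ?E ** (?Ri ** ?Ri) ** ?E"
    by (simp add: CWE matrix_transpose_mul Ri_sym matrix_mul_assoc)
  ultimately have ric: "transpose C\<^sub>W ** C\<^sub>W = - (transpose A ** Q + Q ** A)"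
    by (simp only: eq_neg_iff_add_eq_0 add.commute)
  \<comment> \<open>The closed-loop matrix; its being Hurwitz puts the poles of \<open>K\<close> in the right half-plane.\<close>
  define A' where "A' = A - B\<^sub>W ** ?Ri ** C\<^sub>W"
  have "hurwitz A'"
    using hur by (simp add: A'_def inv_DD CWE matrix_mul_assoc)
  define K where "K = state_tf (- transpose A') (Q ** B) (?Ri ** transpose B\<^sub>W)"

  have GC: "strictly_proper_part G = state_tf A B C"
    unfolding \<open>G = _\<close> transfer_function_def
    by (rule strictly_proper_part_eqI[OF strictly_proper_state_tf])
  define V where "V = transpose (reflect_matrix W)"
  have V: "V = const_matrix R -
      const_matrix (transpose B\<^sub>W) ** resolvent (- transpose A) ** const_matrix (transpose C\<^sub>W)"
  proof -
    have "V = transpose (reflect_matrix (state_tf A B\<^sub>W C\<^sub>W)) + const_matrix R"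
      unfolding V_def \<open>W = _\<close> transfer_function_def reflect_matrix_add transpose_add
        reflect_const_matrix
      by (simp only: transpose_map_matrix R_sym)
    thus ?thesis
      unfolding transpose_reflect_state_tf by (simp add: state_tf_def)
  qed
  \<comment> \<open>\<open>V\<close> is invertible over the rational functions because its limit at infinity is.\<close>
  have "mat_tendsto V (cmatrix R) at_infinity"
    using mat_tendsto_diff[OF at_infinity_le_cofinite mat_tendsto_const[of R]
        strictly_proper_state_tf[of "- transpose A" "transpose C\<^sub>W" "transpose B\<^sub>W",
          unfolded strictly_proper_iff]]
    by (simp add: V state_tf_def)
  moreover have "det (cmatrix R) \<noteq> 0"
  proof -
    have "cmatrix R ** cmatrix ?Ri = mat 1"
      by (simp only: Ri cmatrix_mat_1 flip: cmatrix_mult)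
    hence "det (cmatrix R) * det (cmatrix ?Ri) = 1"
      by (simp flip: det_mul)
    thus ?thesis
      by auto
  qed
  ultimately have "det V \<noteq> 0"
    by (intro rf_det_nonzero[OF at_infinity_le_cofinite _ _ trivial_limit_at_infinity])
      (auto simp only: mat_tendsto_def)
  have "V ** (const_matrix C\<^sub>W ** resolvent A + const_matrix ?Ri ** const_matrix (transpose B\<^sub>W) **
      resolvent (- transpose A') ** const_matrix Q) = const_matrix C ** resolvent A"
    unfolding V
  proof (rule spectral_factor_identity[OF resolvent_right resolvent_left resolvent_right])
    show "const_matrix R ** const_matrix ?Ri = mat 1"
      by (simp only: Ri const_matrix_mat_1 flip: const_matrix_mult)
    have "C = R ** C\<^sub>W + transpose B\<^sub>W ** Q"
      by (simp add: CWE matrix_mul_assoc Ri)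
    thus "const_matrix C = const_matrix R ** const_matrix C\<^sub>W +
        const_matrix (transpose B\<^sub>W) ** const_matrix Q"
      by (simp flip: const_matrix_mult const_matrix_add)
    have "const_matrix (transpose C\<^sub>W) ** const_matrix C\<^sub>W =
        - (const_matrix (transpose A) ** const_matrix Q + const_matrix Q ** const_matrix A)"
      by (simp only: ric const_matrix_minus const_matrix_add flip: const_matrix_mult)
    thus "const_matrix (transpose C\<^sub>W) ** const_matrix C\<^sub>W =
        const_matrix Q ** (mat rf_s - const_matrix A) -
        (mat rf_s - const_matrix (- transpose A)) ** const_matrix Q"
      by (simp add: matrix_ring_simps const_matrix_minus mat_commute)
    have "transpose A' = transpose A - transpose C\<^sub>W ** ?Ri ** transpose B\<^sub>W"
      by (simp add: A'_def transpose_diff matrix_transpose_mul Ri_sym matrix_mul_assoc)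
    hence "transpose C\<^sub>W ** ?Ri ** transpose B\<^sub>W = - transpose A' + transpose A"
      by simp
    thus "const_matrix (transpose C\<^sub>W) ** const_matrix ?Ri ** const_matrix (transpose B\<^sub>W) =
        mat rf_s - const_matrix (- transpose A) - (mat rf_s - const_matrix (- transpose A'))"
      by (simp add: const_matrix_diff const_matrix_minus flip: const_matrix_mult)
  qed
  hence "V ** (const_matrix C\<^sub>W ** resolvent A + const_matrix ?Ri ** const_matrix (transpose B\<^sub>W) **
      resolvent (- transpose A') ** const_matrix Q) ** const_matrix B = state_tf A B C"
    by (simp add: state_tf_def)
  hence "V ** (state_tf A B C\<^sub>W + K) = state_tf A B C"
    by (simp add: K_def state_tf_def const_matrix_mult matrix_ring_simps matrix_mul_assoc)
  hence "matrix_inv V ** state_tf A B C = (matrix_inv V ** V) ** (state_tf A B C\<^sub>W + K)"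
    by (simp only: flip: matrix_mul_assoc)
  also have "\<dots> = state_tf A B C\<^sub>W + K"
    by (simp only: det_nonzero_matrix_inv[OF \<open>det V \<noteq> 0\<close>] matrix_mul_lid)
  finally have "matrix_inv V ** state_tf A B C = state_tf A B C\<^sub>W + K" .
  hence "stable_part (matrix_inv V ** state_tf A B C) = state_tf A B C\<^sub>W"
  proof (intro stable_part_eqI[where K = K])
    show "strictly_proper (state_tf A B C\<^sub>W)" "strictly_proper K"
      unfolding K_def by (rule strictly_proper_state_tf)+
    show "Re z < 0" if "z \<in> matrix_poles (state_tf A B C\<^sub>W)" for z
      using hurwitz_state_tf_poles[OF \<open>hurwitz A\<close> that] .
    show "\<not> Re z < 0" if "z \<in> matrix_poles K" for z
      using anti_hurwitz_state_tf_poles[OF \<open>hurwitz A'\<close>] that unfolding K_def by fastforce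
  qed
  thus ?thesis
    unfolding GC V_def[symmetric] \<open>G\<^sub>\<sigma>\<^sub>A = _\<close> \<open>G\<^sub>B = _\<close> \<open>G\<^sub>C = _\<close> \<open>B\<^sub>X = B\<close> \<open>C\<^sub>Y = C\<^sub>W\<close> by simp
qed

end
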